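(* Let $S=K[t_1,\ldots,t_s]$ be a polynomial ring over a field $K$, let $I=I(G)$ be the edge ideal of a graph $G$ with vertex set $\{t_1,\ldots,t_s\}$, and let $I^*$ be the dual of $I$. Then $I^*$ is normal if and only if $I$ is normal.
   Context: Graphs are finite, with no multiple edges or loops. The edge ideal $I(G)$ is the ideal of $S$ generated by all $t_e:=\prod_{t_i\in e}t_i$ with $e$ an edge of $G$. The dual $I^*$ of $I=I(G)$ is the ideal of $S$ generated by all monomials $t_1\cdots t_s/t_e$ with $e$ an edge of $G$. If $G$ has no edges, $I(G)=(0)$ and $I(G)^*=(0)$. An ideal $J$ is normal if $J^n=\overline{J^n}$ for all $n\geq 1$, where $\overline{J^n}$ is the integral closure of $J^n$. *)

theory Defs
  imports Complex_Main "HOL-Library.Poly_Mapping"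
begin

lemma module_times: "module ((*) :: 'a::comm_ring_1 \<Rightarrow> 'a \<Rightarrow> 'a)"
  by unfold_locales (simp_all add: algebra_simps)

text \<open>The ideal generated by \<open>B\<close> is the submodule spanned by \<open>B\<close> in the ring, viewed as a
  module over itself; in particular the empty set generates the zero ideal.\<close>

definition ideal_gen :: "'a::comm_ring_1 set \<Rightarrow> 'a set" where
  "ideal_gen B = module.span (*) B"

text \<open>For \<open>n = 0\<close> the only generator is the empty product, so \<open>ideal_power J 0\<close> is the whole ring.\<close>

definition ideal_power :: "'a::comm_ring_1 set \<Rightarrow> nat \<Rightarrow> 'a set" where
  "ideal_power J n = ideal_gen {\<Prod>i<n. f i | f. \<forall>i<n. f i \<in> J}"

definition integral_closure :: "'a::comm_ring_1 set \<Rightarrow> 'a set" where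
  "integral_closure J =
     {z. \<exists>n\<ge>1. \<exists>a. (\<forall>i\<in>{1..n}. a i \<in> ideal_power J i) \<and>
           z ^ n + (\<Sum>i=1..n. a i * z ^ (n - i)) = 0}"

definition normal_ideal :: "'a::comm_ring_1 set \<Rightarrow> bool" where
  "normal_ideal J \<longleftrightarrow> (\<forall>n\<ge>1. ideal_power J n = integral_closure (ideal_power J n))"

text \<open>The polynomial ring over \<open>'k\<close> in the variables \<open>t\<^sub>v\<close>, one for each \<open>v :: 'v\<close>: finitely
  supported functions from exponent vectors to coefficients, with the convolution product.
  For finite \<open>'v\<close> this is \<open>K[t\<^sub>1,\<dots>,t\<^sub>s]\<close> with \<open>s = CARD('v)\<close>.\<close>

type_synonym ('v, 'k) mpoly = "('v \<Rightarrow>\<^sub>0 nat) \<Rightarrow>\<^sub>0 'k"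

definition var :: "'v \<Rightarrow> ('v, 'k::field) mpoly" where
  "var v = Poly_Mapping.single (Poly_Mapping.single v 1) 1"

definition simple_graph :: "'v set \<Rightarrow> 'v set set \<Rightarrow> bool" where
  "simple_graph V E \<longleftrightarrow> finite V \<and> (\<forall>e\<in>E. e \<subseteq> V \<and> card e = 2)"

definition edge_monomial :: "'v set \<Rightarrow> ('v, 'k::field) mpoly" where
  "edge_monomial e = (\<Prod>v\<in>e. var v)"

text \<open>The quotient \<open>t\<^sub>1\<cdots>t\<^sub>s / t\<^sub>e\<close> is written as the product of the variables outside \<open>e\<close>.\<close>

definition dual_monomial :: "'v::finite set \<Rightarrow> ('v, 'k::field) mpoly" where
  "dual_monomial e = (\<Prod>v\<in>UNIV - e. var v)"

lemma dual_monomial_times_edge_monomial: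
  "dual_monomial e * edge_monomial e = (\<Prod>v\<in>UNIV. var v :: ('v::finite, 'k::field) mpoly)"
  unfolding dual_monomial_def edge_monomial_def
  by (rule prod.subset_diff[symmetric]) simp_all

definition edge_ideal :: "'v set set \<Rightarrow> ('v, 'k::field) mpoly set" where
  "edge_ideal E = ideal_gen (edge_monomial ` E)"

definition dual_edge_ideal :: "'v::finite set set \<Rightarrow> ('v, 'k::field) mpoly set" where
  "dual_edge_ideal E = ideal_gen (dual_monomial ` E)"

end

theory Submission
  imports Defs
begin

text \<open>
  Normality of a monomial ideal is a statement about exponents only: \<open>I\<close> is normal exactly when
  \<open>(t\<^sup>a)\<^sup>k \<in> I\<^sup>n\<^sup>k\<close> with \<open>k \<ge> 1\<close> always forces \<open>t\<^sup>a \<in> I\<^sup>n\<close>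
  (\<open>normal_monomial_ideal_iff\<close>). For the edge ideal, \<open>t\<^sup>a \<in> I\<^sup>n\<close> says that \<open>n\<close> edges, with
  repetition, can be packed into the vertex capacities \<open>a\<close>. For the dual ideal a vertex \<open>v\<close> is
  missed by \<open>n - deg v\<close> of the \<open>n\<close> chosen edges, so \<open>t\<^sup>a \<in> (I\<^sup>*)\<^sup>n\<close> says that \<open>n\<close> edges cover the
  demands \<open>b = max(n - a, 0)\<close>. Thus normality of \<open>I\<close> is integer rounding for packings, and normality of
  \<open>I\<^sup>*\<close> is integer rounding for coverings.

  The two rounding properties are exchanged by Gallai's identity for weighted matchings: if no
  isolated vertex has positive demand, then the largest packing below \<open>b\<close> and the smallest
  covering above \<open>b\<close> have sizes adding up to \<open>|b| = \<Sum>\<^sub>v b(v)\<close>. Indeed a packing with \<open>n\<close> edges leaves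
  \<open>|b| - 2n\<close> units of demand, each of which one further edge can meet, and a covering with \<open>n\<close>
  edges has \<open>2n - |b|\<close> units of excess, each of which disappears on deleting one edge
  (\<open>packs_imp_covers\<close>, \<open>covers_imp_packs\<close>). Both constants come from the fact that an edge has two
  vertices. Since the identity holds for \<open>b\<close> and for \<open>kb\<close> alike, a gap between the sizes for \<open>b\<close> and
  the scaled sizes for \<open>kb\<close> occurs for packings exactly when it occurs for coverings.

  The algebraic part works over every field and needs neither Newton polyhedra nor linear
  programming duality. If \<open>z\<close> is integral over \<open>L = I\<^sup>n\<close>, then some monomial \<open>g\<close> satisfies
  \<open>g z\<^sup>k \<in> L\<^sup>k\<close> for all \<open>k\<close> (\<open>integral_imp_almost_integral\<close>), and this survives subtracting from \<open>z\<close>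
  all its terms that lie in \<open>L\<close>. If something is left, let \<open>c\<close> be a vertex of the convex hull of its
  support. The term at \<open>kc\<close> cannot cancel in the \<open>k\<close>-th power, so \<open>g t\<^sup>k\<^sup>c \<in> L\<^sup>k\<close> for all \<open>k\<close>, and Dickson's
  lemma removes the factor \<open>g\<close>: some \<open>k \<ge> 1\<close> has \<open>t\<^sup>k\<^sup>c \<in> L\<^sup>k\<close>. The hypothesis on exponents then puts
  \<open>t\<^sup>c\<close> into \<open>L\<close>, although all such terms had been removed.
\<close>

section \<open>Monomial ideals and their powers\<close>

definition monomial_ideal :: "('v \<Rightarrow>\<^sub>0 nat) set \<Rightarrow> ('v, 'k::field) mpoly set" where
  "monomial_ideal U = {f. Poly_Mapping.keys f \<subseteq> U}"

text \<open>The exponents of the monomials in the \<open>n\<close>-th power of the ideal generated by the monomials with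
  exponents \<open>m i\<close>. A product of \<open>n\<close> generators is recorded by the multiplicities \<open>x\<close>, because these
  can be subtracted from one another and compared componentwise.\<close>

definition power_exponents ::
    "'i set \<Rightarrow> ('i \<Rightarrow> 'v \<Rightarrow>\<^sub>0 nat) \<Rightarrow> nat \<Rightarrow> ('v \<Rightarrow>\<^sub>0 nat) set" where
  "power_exponents I m n =
     {a. \<exists>x::'i \<Rightarrow> nat. (\<Sum>i\<in>I. x i) = n \<and>
           (\<forall>v. (\<Sum>i\<in>I. x i * Poly_Mapping.lookup (m i) v) \<le> Poly_Mapping.lookup a v)}"

lemma ex_weights_below:
  fixes x :: "'i \<Rightarrow> nat"
  assumes "finite I" "n \<le> (\<Sum>i\<in>I. x i)"
  shows "\<exists>y. (\<forall>i. y i \<le> x i) \<and> (\<Sum>i\<in>I. y i) = n"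
  using assms(2)
proof (induction n)
  case 0
  show ?case by (rule exI[of _ "\<lambda>_. 0"]) simp
next
  case (Suc n)
  then obtain y where y: "\<forall>i. y i \<le> x i" "(\<Sum>i\<in>I. y i) = n" by auto
  have "\<exists>j\<in>I. y j < x j"
  proof (rule ccontr)
    assume "\<not> ?thesis"
    then have "(\<Sum>i\<in>I. x i) \<le> (\<Sum>i\<in>I. y i)" by (intro sum_mono) (auto simp: not_less)
    with Suc.prems y show False by simp
  qed
  then obtain j where j: "j \<in> I" "y j < x j" by blast
  have "(\<Sum>i\<in>I. (y(j := Suc (y j))) i) = Suc (y j) + (\<Sum>i\<in>I - {j}. (y(j := Suc (y j))) i)"
    using sum.remove[OF assms(1) j(1), of "y(j := Suc (y j))"] by simp
  also have "(\<Sum>i\<in>I - {j}. (y(j := Suc (y j))) i) = (\<Sum>i\<in>I - {j}. y i)"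
    by (rule sum.cong) auto
  also have "Suc (y j) + (\<Sum>i\<in>I - {j}. y i) = Suc n"
    using sum.remove[OF assms(1) j(1), of y] y by simp
  finally show ?case using y j by (intro exI[of _ "y(j := Suc (y j))"]) auto
qed

lemma power_exponents_0: "power_exponents I m 0 = UNIV"
  unfolding power_exponents_def by (auto intro!: exI[of _ "\<lambda>_. 0"])

lemma power_exponents_add:
  assumes "b \<in> power_exponents I m i" "c \<in> power_exponents I m j"
  shows "b + c \<in> power_exponents I m (i + j)"
proof -
  obtain x y where x: "(\<Sum>i\<in>I. x i) = i"
      "\<And>v. (\<Sum>i\<in>I. x i * Poly_Mapping.lookup (m i) v) \<le> Poly_Mapping.lookup b v"
    and y: "(\<Sum>i\<in>I. y i) = j"
      "\<And>v. (\<Sum>i\<in>I. y i * Poly_Mapping.lookup (m i) v) \<le> Poly_Mapping.lookup c v"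
    using assms unfolding power_exponents_def by auto
  show ?thesis unfolding power_exponents_def mem_Collect_eq
    by (rule exI[of _ "\<lambda>i. x i + y i"])
      (auto simp: sum.distrib x(1) y(1) algebra_simps lookup_add intro!: add_mono x(2) y(2))
qed

text \<open>Together with \<open>power_exponents_add\<close> this says that the sets of exponents multiply like powers of
  an ideal; monotonicity in \<open>n\<close> and the computation of ideal powers follow from these two facts.\<close>

lemma power_exponents_split:
  assumes "finite I" "a \<in> power_exponents I m (i + j)"
  obtains b c where "b \<in> power_exponents I m i" "c \<in> power_exponents I m j" "a = b + c"
proof -
  obtain x where x: "(\<Sum>i\<in>I. x i) = i + j"
      "\<And>v. (\<Sum>i\<in>I. x i * Poly_Mapping.lookup (m i) v) \<le> Poly_Mapping.lookup a v"
    using assms(2) unfolding power_exponents_def by auto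
  obtain y where y: "\<And>i. y i \<le> x i" "(\<Sum>i\<in>I. y i) = i"
    using ex_weights_below[OF assms(1), of i x] x(1) by auto
  define b where "b = (\<Sum>i\<in>I. (\<Sum>k<y i. m i))"
  have b: "Poly_Mapping.lookup b v = (\<Sum>i\<in>I. y i * Poly_Mapping.lookup (m i) v)" for v
    unfolding b_def by (simp add: lookup_sum)
  have split: "(\<Sum>i\<in>I. x i * Poly_Mapping.lookup (m i) v) =
      (\<Sum>i\<in>I. y i * Poly_Mapping.lookup (m i) v) +
      (\<Sum>i\<in>I. (x i - y i) * Poly_Mapping.lookup (m i) v)" for v
    unfolding sum.distrib[symmetric]
    by (rule sum.cong) (auto simp: y(1) simp flip: add_mult_distrib)
  have le: "(\<Sum>i\<in>I. (x i - y i) * Poly_Mapping.lookup (m i) v) + Poly_Mapping.lookup b v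
      \<le> Poly_Mapping.lookup a v" for v
    using x(2)[of v] split[of v] b[of v] by simp
  have "b \<in> power_exponents I m i"
    unfolding power_exponents_def using y(2) b by (auto intro!: exI[of _ y])
  moreover have "a - b \<in> power_exponents I m j"
    unfolding power_exponents_def mem_Collect_eq
  proof (intro exI conjI allI)
    have "(\<Sum>i\<in>I. x i) = (\<Sum>i\<in>I. y i) + (\<Sum>i\<in>I. x i - y i)"
      unfolding sum.distrib[symmetric] by (rule sum.cong) (auto simp: y(1))
    then show "(\<Sum>i\<in>I. x i - y i) = j" using x(1) y(2) by simp
    show "(\<Sum>i\<in>I. (x i - y i) * Poly_Mapping.lookup (m i) v) \<le> Poly_Mapping.lookup (a - b) v" for v
      using le[of v] by (simp add: lookup_minus)
  qed
  moreover have "a = b + (a - b)"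
  proof (rule poly_mapping_eqI)
    show "Poly_Mapping.lookup a v = Poly_Mapping.lookup (b + (a - b)) v" for v
      using le[of v] by (simp add: lookup_add lookup_minus)
  qed
  ultimately show thesis by (rule that)
qed

lemma power_exponents_upward:
  "a \<in> power_exponents I m n \<Longrightarrow> a + c \<in> power_exponents I m n"
  using power_exponents_add[of a I m n c 0] by (simp add: power_exponents_0)

lemma power_exponents_antimono:
  assumes "finite I" "a \<in> power_exponents I m n" "k \<le> n"
  shows "a \<in> power_exponents I m k"
  using power_exponents_split[of I a m k "n - k"] power_exponents_upward assms
  by (metis le_add_diff_inverse)

lemma power_exponents_nonempty:
  assumes "finite I" "I \<noteq> {}"
  shows "power_exponents I m n \<noteq> {}"
proof -
  obtain i where i: "i \<in> I" using assms by auto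
  have "(\<Sum>k<n. m i) \<in> power_exponents I m n"
    unfolding power_exponents_def mem_Collect_eq
    using i assms(1)
    by (intro exI[of _ "\<lambda>j. if j = i then n else 0"]) (auto simp: lookup_sum if_distrib[of "\<lambda>x. x * _"] cong: if_cong)
  then show ?thesis by blast
qed

lemma power_exponents_1:
  assumes "finite I"
  shows "power_exponents I m 1 = {b + c | b c. b \<in> m ` I}"
proof (intro equalityI subsetI)
  fix a assume "a \<in> power_exponents I m 1"
  then obtain x where x: "(\<Sum>i\<in>I. x i) = 1"
      "\<And>v. (\<Sum>i\<in>I. x i * Poly_Mapping.lookup (m i) v) \<le> Poly_Mapping.lookup a v"
    unfolding power_exponents_def by auto
  then obtain i where i: "i \<in> I" "x i = 1"
    using sum_eq_1_iff[OF assms, of x] by auto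
  have le: "Poly_Mapping.lookup (m i) v \<le> Poly_Mapping.lookup a v" for v
    using member_le_sum[of i I "\<lambda>i. x i * Poly_Mapping.lookup (m i) v"] i assms x(2)[of v] by simp
  have "a = m i + (a - m i)"
    by (rule poly_mapping_eqI) (use le in \<open>simp add: lookup_add lookup_minus\<close>)
  with i show "a \<in> {b + c | b c. b \<in> m ` I}" by blast
next
  fix a assume "a \<in> {b + c | b c. b \<in> m ` I}"
  then obtain i c where i: "i \<in> I" "a = m i + c" by auto
  have "m i \<in> power_exponents I m 1"
    unfolding power_exponents_def mem_Collect_eq
    using i assms
    by (intro exI[of _ "\<lambda>j. if j = i then 1 else 0"]) (auto simp: if_distrib[of "\<lambda>x. x * _"] cong: if_cong)
  with i show "a \<in> power_exponents I m 1" using power_exponents_upward by blast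
qed

lemma poly_eq_sum_monomials:
  "f = (\<Sum>a\<in>Poly_Mapping.keys f. Poly_Mapping.single a (Poly_Mapping.lookup f a))"
  by (rule poly_mapping_eqI)
    (simp add: lookup_sum lookup_single when_def in_keys_iff)

lemma subspace_monomial_ideal:
  fixes U :: "('v \<Rightarrow>\<^sub>0 nat) set"
  assumes "\<And>a c. a \<in> U \<Longrightarrow> a + c \<in> U"
  shows "module.subspace (*) (monomial_ideal U :: ('v, 'k::field) mpoly set)"
proof -
  have "f * g \<in> monomial_ideal U" if "g \<in> monomial_ideal U" for f g :: "('v, 'k) mpoly"
  proof -
    have "a + b \<in> U" if "b \<in> Poly_Mapping.keys g" for a b
      using that \<open>g \<in> _\<close> assms[of b a] unfolding monomial_ideal_def by (auto simp: add.commute)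
    then show ?thesis unfolding monomial_ideal_def using keys_mult[of f g] by blast
  qed
  moreover have "f + g \<in> monomial_ideal U"
    if "f \<in> monomial_ideal U" "g \<in> monomial_ideal U" for f g :: "('v, 'k) mpoly"
    using that keys_add[of f g] unfolding monomial_ideal_def by blast
  moreover have "(0 :: ('v, 'k) mpoly) \<in> monomial_ideal U"
    unfolding monomial_ideal_def by simp
  ultimately show ?thesis by (simp add: module.subspace_def[OF module_times])
qed

lemma ideal_gen_mult: "g \<in> ideal_gen B \<Longrightarrow> f * g \<in> ideal_gen B"
  unfolding ideal_gen_def by (rule module.span_scale[OF module_times])

lemma ideal_gen_base: "g \<in> B \<Longrightarrow> g \<in> ideal_gen B"
  unfolding ideal_gen_def by (rule module.span_base[OF module_times])

lemma ideal_gen_sum: "(\<And>a. a \<in> A \<Longrightarrow> f a \<in> ideal_gen B) \<Longrightarrow> sum f A \<in> ideal_gen B"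
  unfolding ideal_gen_def by (rule module.span_sum[OF module_times])

text \<open>Since every polynomial is the sum of its terms, it is enough to generate the terms.\<close>

lemma ideal_gen_eq_monomial_ideal:
  fixes B :: "('v, 'k::field) mpoly set"
  assumes "\<And>a c. a \<in> U \<Longrightarrow> a + c \<in> U"
    and "B \<subseteq> monomial_ideal U"
    and "\<And>a q. a \<in> U \<Longrightarrow> Poly_Mapping.single a q \<in> ideal_gen B"
  shows "ideal_gen B = monomial_ideal U"
proof
  show "ideal_gen B \<subseteq> monomial_ideal U"
    unfolding ideal_gen_def
    by (rule module.span_minimal[OF module_times assms(2) subspace_monomial_ideal[OF assms(1)]])
  show "monomial_ideal U \<subseteq> ideal_gen B"
  proof
    fix f :: "('v, 'k) mpoly" assume "f \<in> monomial_ideal U"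
    then have "(\<Sum>a\<in>Poly_Mapping.keys f. Poly_Mapping.single a (Poly_Mapping.lookup f a)) \<in> ideal_gen B"
      by (intro ideal_gen_sum assms(3)) (auto simp: monomial_ideal_def)
    then show "f \<in> ideal_gen B" using poly_eq_sum_monomials[of f] by simp
  qed
qed

lemma ideal_gen_monomials:
  assumes "finite I"
  shows "ideal_gen ((\<lambda>i. Poly_Mapping.single (m i) 1) ` I) =
    (monomial_ideal (power_exponents I m 1) :: ('v, 'k::field) mpoly set)"
proof (rule ideal_gen_eq_monomial_ideal)
  show "a + c \<in> power_exponents I m 1" if "a \<in> power_exponents I m 1" for a c
    using that by (rule power_exponents_upward)
  show "(\<lambda>i. Poly_Mapping.single (m i) 1) ` I \<subseteq> monomial_ideal (power_exponents I m 1)"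
    unfolding monomial_ideal_def power_exponents_1[OF assms]
    by auto (metis add_0_right imageI)
  fix a :: "'v \<Rightarrow>\<^sub>0 nat" and q :: 'k
  assume "a \<in> power_exponents I m 1"
  then obtain i c where "i \<in> I" "a = m i + c" unfolding power_exponents_1[OF assms] by auto
  then have "Poly_Mapping.single a q = Poly_Mapping.single c q * Poly_Mapping.single (m i) 1"
    by (simp add: mult_single add.commute)
  moreover have "Poly_Mapping.single (m i) 1 \<in> (\<lambda>i. Poly_Mapping.single (m i) (1::'k)) ` I"
    using \<open>i \<in> I\<close> by (rule imageI)
  ultimately show "Poly_Mapping.single a q \<in> ideal_gen ((\<lambda>i. Poly_Mapping.single (m i) 1) ` I)"
    by (simp add: ideal_gen_mult ideal_gen_base)
qed

lemma monomial_ideal_power_mult: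
  fixes f g :: "('v, 'k::field) mpoly"
  assumes "f \<in> monomial_ideal (power_exponents I m i)" "g \<in> monomial_ideal (power_exponents I m j)"
  shows "f * g \<in> monomial_ideal (power_exponents I m (i + j))"
  using assms keys_mult[of f g] power_exponents_add[of _ I m i _ j]
  unfolding monomial_ideal_def by blast

lemma prod_single:
  "(\<Prod>i\<in>A. Poly_Mapping.single (g i) (1::'k::field)) = Poly_Mapping.single (\<Sum>i\<in>A. g i) 1"
  by (induction A rule: infinite_finite_induct) (simp_all add: mult_single)

lemma ideal_power_monomial_ideal:
  assumes "finite I"
  shows "ideal_power (monomial_ideal (power_exponents I m k) :: ('v, 'k::field) mpoly set) n =
    monomial_ideal (power_exponents I m (k * n))"
  unfolding ideal_power_def
proof (rule ideal_gen_eq_monomial_ideal)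
  show "a + c \<in> power_exponents I m (k * n)" if "a \<in> power_exponents I m (k * n)" for a c
    using that by (rule power_exponents_upward)
  have "(\<Prod>i<n. f i) \<in> monomial_ideal (power_exponents I m (k * n))"
    if "\<forall>i<n. f i \<in> monomial_ideal (power_exponents I m k)" for f :: "nat \<Rightarrow> ('v, 'k) mpoly"
    using that
  proof (induction n)
    case 0
    show ?case by (simp add: monomial_ideal_def power_exponents_0)
  next
    case (Suc n)
    then show ?case
      using monomial_ideal_power_mult[of "f n" I m k "\<Prod>i<n. f i" "k * n"]
      by (simp add: mult.commute)
  qed
  then show "{\<Prod>i<n. f i |f. \<forall>i<n. f i \<in> (monomial_ideal (power_exponents I m k) :: ('v, 'k) mpoly set)}
      \<subseteq> monomial_ideal (power_exponents I m (k * n))"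
    by blast
  fix a :: "'v \<Rightarrow>\<^sub>0 nat" and q :: 'k
  assume a: "a \<in> power_exponents I m (k * n)"
  have "\<exists>g c. (\<forall>i<n. g i \<in> power_exponents I m k) \<and> a = c + (\<Sum>i<n. g i)"
    using a
  proof (induction n arbitrary: a)
    case (Suc n)
    then have "a \<in> power_exponents I m (k + k * n)" by simp
    then obtain b b' where b: "b \<in> power_exponents I m k" "b' \<in> power_exponents I m (k * n)" "a = b + b'"
      by (rule power_exponents_split[OF assms])
    obtain g c where g: "\<forall>i<n. g i \<in> power_exponents I m k" "b' = c + (\<Sum>i<n. g i)"
      using Suc.IH[OF b(2)] by auto
    have "(\<Sum>i<Suc n. (g(n := b)) i) = b + (\<Sum>i<n. g i)" by (simp add: add.commute)
    then show ?case using g b by (intro exI[of _ "g(n := b)"] exI[of _ c]) (auto simp: less_Suc_eq ac_simps)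
  qed simp
  then obtain g c where g: "\<forall>i<n. g i \<in> power_exponents I m k" "a = c + (\<Sum>i<n. g i)"
    by blast
  have "Poly_Mapping.single a q = Poly_Mapping.single c q * (\<Prod>i<n. Poly_Mapping.single (g i) 1)"
    by (simp add: prod_single mult_single g(2))
  moreover have "(\<Prod>i<n. Poly_Mapping.single (g i) (1::'k)) \<in>
      {\<Prod>i<n. f i |f. \<forall>i<n. f i \<in> monomial_ideal (power_exponents I m k)}"
    using g(1) by (auto simp: monomial_ideal_def intro!: exI[of _ "\<lambda>i. Poly_Mapping.single (g i) 1"])
  ultimately show "Poly_Mapping.single a q \<in>
      ideal_gen {\<Prod>i<n. f i |f. \<forall>i<n. f i \<in> monomial_ideal (power_exponents I m k)}"
    by (simp only: ideal_gen_mult ideal_gen_base)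
qed

section \<open>Normality of monomial ideals in terms of exponents\<close>

text \<open>Every sequence of natural numbers has a nondecreasing subsequence, and one can pass to
  subsequences one coordinate at a time.\<close>

lemma dickson:
  fixes f :: "nat \<Rightarrow> 'a \<Rightarrow> nat"
  assumes "finite X"
  shows "\<exists>r::nat \<Rightarrow> nat. strict_mono r \<and> (\<forall>x\<in>X. incseq (\<lambda>n. f (r n) x))"
  using assms
proof (induction X rule: finite_induct)
  case empty
  show ?case by (auto intro!: exI[of _ id] strict_mono_id)
next
  case (insert x X)
  then obtain r where r: "strict_mono r" "\<And>y. y \<in> X \<Longrightarrow> incseq (\<lambda>n. f (r n) y)" by auto
  obtain q :: "nat \<Rightarrow> nat" where q: "strict_mono q" "monoseq (\<lambda>n. f (r (q n)) x)"
    using seq_monosub[of "\<lambda>n. f (r n) x"] by auto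
  let ?s = "\<lambda>n. f (r (q n)) x"
  have "\<exists>N. incseq (\<lambda>n. ?s (n + N))"
    using q(2) unfolding monoseq_iff
  proof
    assume "incseq ?s"
    then show ?thesis by (auto intro!: exI[of _ 0])
  next
    assume dec: "decseq ?s"
    define l where "l = (LEAST y. y \<in> range ?s)"
    \<comment> \<open>A nonincreasing sequence of naturals is constant once it has reached its least value.\<close>
    have "l \<in> range ?s" unfolding l_def by (rule LeastI_ex) blast
    then obtain N where N: "?s N = l" by auto
    have "?s (n + N) = l" for n
      using decseqD[OF dec, of N "n + N"] N Least_le[of "\<lambda>y. y \<in> range ?s" "?s (n + N)"]
      unfolding l_def by fastforce
    then show ?thesis by (auto simp: incseq_def intro!: exI[of _ N])
  qed
  then obtain N where N: "incseq (\<lambda>n. ?s (n + N))" by blast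
  define p where "p = (\<lambda>n. q (n + N))"
  have p: "strict_mono p" using q(1) by (auto simp: p_def strict_mono_def)
  have "incseq (\<lambda>n. f (r (p n)) y)" if "y \<in> insert x X" for y
  proof (cases "y = x")
    case True
    with N show ?thesis by (simp add: p_def)
  next
    case False
    with that r(2) have "incseq (\<lambda>n. f (r n) y)" by auto
    then show ?thesis using strict_mono_less_eq[OF p] by (simp add: incseq_def)
  qed
  moreover have "strict_mono (\<lambda>n. r (p n))"
    using strict_mono_o[OF r(1) p] by (simp add: o_def)
  ultimately show ?case by blast
qed

text \<open>Write \<open>d + kc\<close> as a sum of \<open>nk\<close> generators plus a remainder. By Dickson's lemma there are
  \<open>k < l\<close> for which both the multiplicities of the generators and the remainders are
  componentwise comparable; the difference of the two decompositions exhibits \<open>(l - k)c\<close> as a sum of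
  \<open>n(l - k)\<close> generators plus a remainder, and \<open>d\<close> has cancelled.\<close>

lemma bounded_distance_imp_multiple_mem:
  fixes m :: "'i \<Rightarrow> 'v::finite \<Rightarrow>\<^sub>0 nat"
  assumes "finite I" "\<And>k. d + (\<Sum>i<k. c) \<in> power_exponents I m (n * k)"
  shows "\<exists>k\<ge>1. (\<Sum>i<k. c) \<in> power_exponents I m (n * k)"
proof -
  let ?S = "\<lambda>x v. \<Sum>i\<in>I. x i * Poly_Mapping.lookup (m i) v"
  let ?a = "\<lambda>k v. Poly_Mapping.lookup d v + k * Poly_Mapping.lookup c v"
  have "\<exists>x. (\<Sum>i\<in>I. x i) = n * k \<and> (\<forall>v. ?S x v \<le> ?a k v)" for k
    using assms(2)[of k] unfolding power_exponents_def by (simp add: lookup_add lookup_sum)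
  then obtain x where x: "\<And>k. (\<Sum>i\<in>I. x k i) = n * k" "\<And>k v. ?S (x k) v \<le> ?a k v" by metis
  define f where "f = (\<lambda>k. case_sum (x k) (\<lambda>v. ?a k v - ?S (x k) v))"
  obtain r where r: "strict_mono r" "\<And>y. y \<in> I <+> UNIV \<Longrightarrow> incseq (\<lambda>n. f (r n) y)"
    using dickson[of "I <+> UNIV" f] assms(1) by auto
  define k l where "k = r 0" and "l = r 1"
  have kl: "k < l" using r(1) by (simp add: k_def l_def strict_mono_def)
  have fle: "f k y \<le> f l y" if "y \<in> I <+> UNIV" for y
    using incseqD[OF r(2)[OF that], of 0 1] by (simp add: k_def l_def)
  have xle: "x k i \<le> x l i" if "i \<in> I" for i
    using fle[OF InlI[OF that]] by (simp add: f_def)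
  have sle: "?a k v - ?S (x k) v \<le> ?a l v - ?S (x l) v" for v
    using fle[OF InrI[OF UNIV_I]] by (simp add: f_def)
  have "(\<Sum>i<l - k. c) \<in> power_exponents I m (n * (l - k))"
    unfolding power_exponents_def mem_Collect_eq
  proof (intro exI conjI allI)
    have "(\<Sum>i\<in>I. x l i) = (\<Sum>i\<in>I. x k i) + (\<Sum>i\<in>I. x l i - x k i)"
      unfolding sum.distrib[symmetric] by (rule sum.cong) (auto simp: xle)
    then show "(\<Sum>i\<in>I. x l i - x k i) = n * (l - k)"
      by (simp add: x(1) diff_mult_distrib2)
    fix v
    have "?S (x l) v = ?S (x k) v + ?S (\<lambda>i. x l i - x k i) v"
      unfolding sum.distrib[symmetric]
      by (rule sum.cong) (auto simp: xle simp flip: add_mult_distrib)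
    moreover have "l * Poly_Mapping.lookup c v =
        k * Poly_Mapping.lookup c v + (l - k) * Poly_Mapping.lookup c v"
      using kl by (simp flip: add_mult_distrib)
    ultimately show "?S (\<lambda>i. x l i - x k i) v \<le> Poly_Mapping.lookup (\<Sum>i<l - k. c) v"
      using sle[of v] x(2)[of k v] x(2)[of l v] by (simp add: lookup_sum)
  qed
  with kl show ?thesis by (intro exI[of _ "l - k"]) auto
qed

text \<open>For an additive weight \<open>w\<close> this makes \<open>c\<close> a vertex of the Newton polytope of \<open>f\<close>, with \<open>w\<close> as
  the functional that exposes it.\<close>

definition exposed_key :: "(('v \<Rightarrow>\<^sub>0 nat) \<Rightarrow> nat) \<Rightarrow> ('v, 'k::field) mpoly \<Rightarrow> ('v \<Rightarrow>\<^sub>0 nat) \<Rightarrow> bool" where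
  "exposed_key w f c \<longleftrightarrow> c \<in> Poly_Mapping.keys f \<and> (\<forall>b\<in>Poly_Mapping.keys f. b \<noteq> c \<longrightarrow> w b < w c)"

text \<open>The exponent \<open>c + d\<close> arises in \<open>f * g\<close> only from the pair \<open>(c, d)\<close>, since every other pair has
  smaller weight; hence its coefficient is a product of two nonzero field elements.\<close>

lemma exposed_key_mult:
  fixes f g :: "('v, 'k::field) mpoly"
  assumes w: "\<And>a b. w (a + b) = w a + w b"
    and f: "exposed_key w f c" and g: "exposed_key w g d"
  shows "exposed_key w (f * g) (c + d)"
proof -
  have less: "w (a + b) < w (c + d)"
    if "a \<in> Poly_Mapping.keys f" "b \<in> Poly_Mapping.keys g" "(a, b) \<noteq> (c, d)" for a b
    using that f g unfolding exposed_key_def w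
    by (cases "a = c"; cases "b = d") (auto intro: add_strict_mono)
  let ?K = "Poly_Mapping.keys f \<times> Poly_Mapping.keys g"
  let ?t = "\<lambda>(a, b). Poly_Mapping.single (a + b) (Poly_Mapping.lookup f a * Poly_Mapping.lookup g b)"
  have "f * g = (\<Sum>a\<in>Poly_Mapping.keys f. Poly_Mapping.single a (Poly_Mapping.lookup f a)) *
      (\<Sum>b\<in>Poly_Mapping.keys g. Poly_Mapping.single b (Poly_Mapping.lookup g b))"
    using poly_eq_sum_monomials[of f] poly_eq_sum_monomials[of g] by simp
  also have "\<dots> = (\<Sum>p\<in>?K. ?t p)"
    by (simp add: sum_product sum.cartesian_product mult_single)
  finally have "Poly_Mapping.lookup (f * g) (c + d) = (\<Sum>p\<in>?K. Poly_Mapping.lookup (?t p) (c + d))"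
    by (simp add: lookup_sum)
  also have "\<dots> = (\<Sum>p\<in>?K. if p = (c, d) then Poly_Mapping.lookup f c * Poly_Mapping.lookup g d else 0)"
  proof (rule sum.cong)
    fix p assume p: "p \<in> ?K"
    show "Poly_Mapping.lookup (?t p) (c + d) =
        (if p = (c, d) then Poly_Mapping.lookup f c * Poly_Mapping.lookup g d else 0)"
    proof (cases "p = (c, d)")
      case False
      with less[of "fst p" "snd p"] p have "fst p + snd p \<noteq> c + d" by auto
      with False show ?thesis by (auto simp: lookup_single when_def split: prod.splits)
    qed simp
  qed simp
  also have "\<dots> = Poly_Mapping.lookup f c * Poly_Mapping.lookup g d"
    using f g by (simp add: exposed_key_def)
  finally have "c + d \<in> Poly_Mapping.keys (f * g)"
    using f g by (simp add: exposed_key_def in_keys_iff)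
  moreover have "w b < w (c + d)" if "b \<in> Poly_Mapping.keys (f * g)" "b \<noteq> c + d" for b
    using that keys_mult[of f g] less by blast
  ultimately show ?thesis unfolding exposed_key_def by blast
qed

lemma exposed_key_power:
  fixes f :: "('v, 'k::field) mpoly"
  assumes "\<And>a b. w (a + b) = w a + w b" "exposed_key w f c"
  shows "exposed_key w (f ^ k) (\<Sum>i<k. c)"
proof (induction k)
  case 0
  show ?case by (simp add: exposed_key_def)
next
  case (Suc k)
  show ?case using exposed_key_mult[OF assms Suc] by (simp add: add.commute)
qed

text \<open>An exponent \<open>c\<close> of largest Euclidean norm is exposed by the inner product with \<open>c\<close> itself:
  if \<open>|b| \<le> |c|\<close> and \<open>b \<noteq> c\<close>, then expanding \<open>|b - c|\<^sup>2 > 0\<close> gives \<open>\<langle>b, c\<rangle> < \<langle>c, c\<rangle>\<close>. This avoids any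
  choice of a monomial order.\<close>

lemma ex_exposed_key:
  fixes f :: "('v::finite, 'k::field) mpoly"
  assumes "f \<noteq> 0"
  obtains w c where "\<And>a b. w (a + b) = w a + w b" "exposed_key w f c"
proof -
  let ?N = "\<lambda>a. \<Sum>v\<in>UNIV. (Poly_Mapping.lookup a v)\<^sup>2"
  have fin: "finite (?N ` Poly_Mapping.keys f)" and ne: "?N ` Poly_Mapping.keys f \<noteq> {}"
    using assms by (auto simp: poly_mapping_eq_iff in_keys_iff fun_eq_iff)
  obtain c where c: "c \<in> Poly_Mapping.keys f" "?N c = Max (?N ` Poly_Mapping.keys f)"
    using Max_in[OF fin ne] by auto
  define w where "w = (\<lambda>a. \<Sum>v\<in>UNIV. Poly_Mapping.lookup a v * Poly_Mapping.lookup c v)"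
  have "w b < w c" if b: "b \<in> Poly_Mapping.keys f" "b \<noteq> c" for b
  proof -
    let ?b = "\<lambda>v. int (Poly_Mapping.lookup b v)" and ?c = "\<lambda>v. int (Poly_Mapping.lookup c v)"
    have "?N b \<le> ?N c" using Max_ge[OF fin, of "?N b"] b c by simp
    then have le: "(\<Sum>v\<in>UNIV. (?b v)\<^sup>2) \<le> (\<Sum>v\<in>UNIV. (?c v)\<^sup>2)"
      by (simp flip: of_nat_power of_nat_sum)
    obtain v0 where v0: "?b v0 \<noteq> ?c v0"
      using b(2) by (auto simp: poly_mapping_eq_iff fun_eq_iff)
    have "0 < (\<Sum>v\<in>UNIV. (?b v - ?c v)\<^sup>2)"
      using v0 by (intro sum_pos2[of _ v0]) auto
    also have "\<dots> = (\<Sum>v\<in>UNIV. (?b v)\<^sup>2) + (\<Sum>v\<in>UNIV. (?c v)\<^sup>2) - 2 * (\<Sum>v\<in>UNIV. ?b v * ?c v)"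
      by (simp add: power2_diff sum.distrib sum_subtractf sum_distrib_left mult.assoc)
    finally have "(\<Sum>v\<in>UNIV. ?b v * ?c v) < (\<Sum>v\<in>UNIV. ?c v * ?c v)"
      using le by (simp add: power2_eq_square)
    then show ?thesis unfolding w_def by (simp flip: of_nat_mult of_nat_sum)
  qed
  with c(1) have "exposed_key w f c" unfolding exposed_key_def by blast
  moreover have "w (a + b) = w a + w b" for a b
    unfolding w_def by (simp add: lookup_add sum.distrib algebra_simps)
  ultimately show thesis using that by blast
qed

text \<open>The equation of integral dependence rewrites \<open>z\<^sup>k\<close> with \<open>k \<ge> n\<close> as a combination of lower powers
  \<open>z\<^sup>k\<^sup>-\<^sup>i\<close> with coefficients in \<open>L i\<close>, so membership of \<open>g z\<^sup>k\<close> in \<open>L k\<close> propagates upwards. For \<open>k < n\<close>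
  it holds because \<open>g\<close> already lies in \<open>L n \<subseteq> L k\<close>. Here \<open>L k\<close> stands for the \<open>k\<close>-th power of an ideal.\<close>

lemma integral_imp_almost_integral:
  fixes z g :: "'a::comm_ring_1" and L :: "nat \<Rightarrow> 'a set"
  assumes mult: "\<And>i j f h. f \<in> L i \<Longrightarrow> h \<in> L j \<Longrightarrow> f * h \<in> L (i + j)"
    and sum: "\<And>(A::nat set) f k. (\<And>i. i \<in> A \<Longrightarrow> f i \<in> L k) \<Longrightarrow> - sum f A \<in> L k"
    and top: "\<And>f. f \<in> L 0"
    and dec: "\<And>i j f. f \<in> L j \<Longrightarrow> i \<le> j \<Longrightarrow> f \<in> L i"
    and a: "\<And>i. i \<in> {1..n} \<Longrightarrow> a i \<in> L i"
    and eq: "z ^ n + (\<Sum>i=1..n. a i * z ^ (n - i)) = 0"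
    and g: "g \<in> L n"
  shows "g * z ^ k \<in> L k"
proof (induction k rule: less_induct)
  case (less k)
  show ?case
  proof (cases "k < n")
    case True
    have "g * z ^ k \<in> L (n + 0)" by (rule mult[OF g top])
    then show ?thesis using dec[of _ n k] True by simp
  next
    case False
    have "z ^ n = - (\<Sum>i=1..n. a i * z ^ (n - i))"
      using eq by (simp add: eq_neg_iff_add_eq_0)
    then have "g * z ^ k = g * z ^ (k - n) * (- (\<Sum>i=1..n. a i * z ^ (n - i)))"
      using False by (metis le_add_diff_inverse2 linorder_not_less mult.assoc power_add)
    also have "\<dots> = - (\<Sum>i=1..n. a i * (g * z ^ (k - i)))"
    proof -
      have "g * z ^ (k - n) * (a i * z ^ (n - i)) = a i * (g * z ^ (k - i))" if "i \<in> {1..n}" for i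
      proof -
        have "k - i = (k - n) + (n - i)" using that False by auto
        then have "z ^ (k - i) = z ^ (k - n) * z ^ (n - i)" by (simp add: power_add)
        then show ?thesis by (simp add: ac_simps)
      qed
      then show ?thesis by (simp add: sum_distrib_left)
    qed
    also have "\<dots> \<in> L k"
    proof (rule sum)
      fix i assume i: "i \<in> {1..n}"
      then have "a i * (g * z ^ (k - i)) \<in> L (i + (k - i))"
        using False by (intro mult a less) auto
      then show "a i * (g * z ^ (k - i)) \<in> L k" using i False by simp
    qed
    finally show ?thesis .
  qed
qed

text \<open>If \<open>t\<^sup>k\<^sup>a\<close> lies in the \<open>k\<close>-th power of \<open>L = I\<^sup>n\<close>, then \<open>X\<^sup>k - t\<^sup>k\<^sup>a\<close> is an equation of integral dependence
  for \<open>t\<^sup>a\<close> over \<open>L\<close>; this gives one direction. In the other direction the generating set must be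
  nonempty, so that the powers of the ideal contain monomials to serve as the multiplier \<open>g\<close>.\<close>

theorem normal_monomial_ideal_iff:
  fixes m :: "'i \<Rightarrow> 'v::finite \<Rightarrow>\<^sub>0 nat"
  assumes I: "finite I" "I \<noteq> {}"
  shows "normal_ideal (monomial_ideal (power_exponents I m 1) :: ('v, 'k::field) mpoly set) \<longleftrightarrow>
    (\<forall>n\<ge>1. \<forall>k\<ge>1. \<forall>a. (\<Sum>i<k. a) \<in> power_exponents I m (n * k) \<longrightarrow> a \<in> power_exponents I m n)"
    (is "?normal \<longleftrightarrow> ?saturated")
proof -
  let ?U = "power_exponents I m"
  let ?L = "\<lambda>n. monomial_ideal (?U n) :: ('v, 'k) mpoly set"
  have normal: "?normal \<longleftrightarrow> (\<forall>n\<ge>1. ?L n = integral_closure (?L n))"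
    unfolding normal_ideal_def ideal_power_monomial_ideal[OF I(1)] by simp
  have closure: "z \<in> integral_closure (?L n) \<longleftrightarrow>
      (\<exists>l\<ge>1. \<exists>a. (\<forall>i\<in>{1..l}. a i \<in> ?L (n * i)) \<and> z ^ l + (\<Sum>i=1..l. a i * z ^ (l - i)) = 0)" for z n
    unfolding integral_closure_def ideal_power_monomial_ideal[OF I(1)] by simp
  have subspace: "module.subspace (*) (?L n)" for n
    by (rule subspace_monomial_ideal) (rule power_exponents_upward)
  note scale = module.subspace_scale[OF module_times subspace]
    and add = module.subspace_add[OF module_times subspace]
    and neg = module.subspace_neg[OF module_times subspace]
    and sum = module.subspace_sum[OF module_times subspace]
  show ?thesis
  proof
    assume ?normal
    show ?saturated
    proof (intro allI impI)
      fix n k :: nat and a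
      assume n: "n \<ge> 1" and k: "k \<ge> 1" and a: "(\<Sum>i<k. a) \<in> ?U (n * k)"
      let ?z = "Poly_Mapping.single a 1 :: ('v, 'k) mpoly"
      have zk: "?z ^ k = Poly_Mapping.single (\<Sum>i<k. a) 1"
        using prod_single[of "\<lambda>_. a" "{..<k}"] by simp
      define b where "b = (\<lambda>i. if i = k then - (?z ^ k) else 0)"
      have "(\<Sum>i=1..k. b i * ?z ^ (k - i)) = - (?z ^ k)"
        using k by (simp add: b_def if_distrib[of "\<lambda>x. x * _"] cong: if_cong)
      moreover have "\<forall>i\<in>{1..k}. b i \<in> ?L (n * i)"
        using a by (auto simp: b_def zk monomial_ideal_def simp del: sum_constant)
      ultimately have "?z \<in> integral_closure (?L n)"
        unfolding closure using k by (intro exI[of _ k] conjI exI[of _ b]) auto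
      then have "?z \<in> ?L n" using \<open>?normal\<close> n unfolding normal by blast
      then show "a \<in> ?U n" by (simp add: monomial_ideal_def)
    qed
  next
    assume sat: ?saturated
    have "integral_closure (?L n) \<subseteq> ?L n" if n: "n \<ge> 1" for n
    proof
      fix z assume "z \<in> integral_closure (?L n)"
      then obtain l a where a: "\<And>i. i \<in> {1..l} \<Longrightarrow> a i \<in> ?L (n * i)"
          and eq: "z ^ l + (\<Sum>i=1..l. a i * z ^ (l - i)) = 0"
        unfolding closure by blast
      obtain d where d: "d \<in> ?U (n * l)" using power_exponents_nonempty[OF I] by blast
      let ?g = "Poly_Mapping.single d 1 :: ('v, 'k) mpoly"
      have gz: "?g * z ^ k \<in> ?L (n * k)" for k
      proof (rule integral_imp_almost_integral[where L = "\<lambda>i. ?L (n * i)" and a = a and n = l])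
        show "f * h \<in> ?L (n * (i + j))" if "f \<in> ?L (n * i)" "h \<in> ?L (n * j)" for i j f h
          using monomial_ideal_power_mult[OF that] by (simp add: distrib_left)
        show "- sum f A \<in> ?L (n * k)" if "\<And>i. i \<in> A \<Longrightarrow> f i \<in> ?L (n * k)" for A :: "nat set" and f k
          using that by (intro neg sum)
        show "f \<in> ?L (n * 0)" for f by (simp add: monomial_ideal_def power_exponents_0)
        show "f \<in> ?L (n * i)" if "f \<in> ?L (n * j)" "i \<le> j" for i j f
          using that power_exponents_antimono[OF I(1), of _ m "n * j" "n * i"]
          unfolding monomial_ideal_def by auto
        show "?g \<in> ?L (n * l)" using d by (simp add: monomial_ideal_def)
      qed (use a eq in auto)
      let ?good = "Poly_Mapping.keys z \<inter> ?U n" and ?bad = "Poly_Mapping.keys z - ?U n"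
      \<comment> \<open>Split off the part of \<open>z\<close> that lies in \<open>L\<close>; it remains to see that nothing else is left.\<close>
      define y where "y = (\<Sum>a\<in>?good. Poly_Mapping.single a (Poly_Mapping.lookup z a))"
      define z' where "z' = (\<Sum>a\<in>?bad. Poly_Mapping.single a (Poly_Mapping.lookup z a))"
      have y: "y \<in> ?L n" unfolding y_def by (rule sum) (auto simp: monomial_ideal_def)
      have zy: "z = z' + y"
        using poly_eq_sum_monomials[of z] sum.Int_Diff[of "Poly_Mapping.keys z"
            "\<lambda>a. Poly_Mapping.single a (Poly_Mapping.lookup z a)" "?U n"]
        by (simp add: y_def z'_def add.commute)
      have keys_z': "Poly_Mapping.keys z' \<subseteq> ?bad"
        unfolding z'_def by (rule order.trans[OF keys_sum]) auto
      have powy: "(- y) ^ j \<in> ?L (n * j)" for j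
      proof (induction j)
        case 0
        show ?case by (simp add: monomial_ideal_def power_exponents_0)
      next
        case (Suc j)
        then show ?case using monomial_ideal_power_mult[OF neg[OF y] Suc] by simp
      qed
      have gz': "?g * z' ^ k \<in> ?L (n * k)" for k
      proof -
        have "?g * z' ^ k = ?g * (z + (- y)) ^ k" by (simp add: zy)
        also have "\<dots> = (\<Sum>j\<le>k. of_nat (k choose j) * (?g * z ^ j * (- y) ^ (k - j)))"
          unfolding binomial_ring by (simp add: sum_distrib_left ac_simps)
        also have "\<dots> \<in> ?L (n * k)"
        proof (rule sum, rule scale)
          fix j assume "j \<in> {..k}"
          then show "?g * z ^ j * (- y) ^ (k - j) \<in> ?L (n * k)"
            using monomial_ideal_power_mult[OF gz powy, of j "k - j"] by (simp flip: distrib_left)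
        qed
        finally show ?thesis .
      qed
      have "z' = 0"
      proof (rule ccontr)
        assume "z' \<noteq> 0"
        then obtain w c where w: "\<And>a b. w (a + b) = w a + (w b :: nat)" and c: "exposed_key w z' c"
          using ex_exposed_key by blast
        have "d + (\<Sum>i<k. c) \<in> ?U (n * k)" for k
        proof -
          have "exposed_key w (?g * z' ^ k) (d + (\<Sum>i<k. c))"
            by (rule exposed_key_mult[OF w _ exposed_key_power[OF w c]]) (simp add: exposed_key_def)
          then show ?thesis using gz'[of k] by (auto simp: exposed_key_def monomial_ideal_def)
        qed
        then have "\<exists>k\<ge>1. (\<Sum>i<k. c) \<in> ?U (n * k)"
          by (rule bounded_distance_imp_multiple_mem[OF I(1)])
        then have "c \<in> ?U n" using sat n by blast
        moreover have "c \<in> ?bad" using c keys_z' by (auto simp: exposed_key_def)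
        ultimately show False by blast
      qed
      with zy y show "z \<in> ?L n" by simp
    qed
    moreover have "?L n \<subseteq> integral_closure (?L n)" for n
    proof
      fix z assume "z \<in> ?L n"
      then show "z \<in> integral_closure (?L n)"
        unfolding closure using neg
        by (intro exI[of _ 1] conjI exI[of _ "\<lambda>_. - z"]) auto
    qed
    ultimately show ?normal unfolding normal by blast
  qed
qed

section \<open>Packing and covering by edges\<close>

definition edge_degree :: "'v set set \<Rightarrow> ('v set \<Rightarrow> nat) \<Rightarrow> 'v \<Rightarrow> nat" where
  "edge_degree E x v = (\<Sum>e\<in>E. x e * of_bool (v \<in> e))"

definition packs :: "'v set set \<Rightarrow> ('v \<Rightarrow> nat) \<Rightarrow> nat \<Rightarrow> bool" where
  "packs E b n \<longleftrightarrow> (\<exists>x. (\<Sum>e\<in>E. x e) = n \<and> (\<forall>v. edge_degree E x v \<le> b v))"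

definition covers :: "'v set set \<Rightarrow> ('v \<Rightarrow> nat) \<Rightarrow> nat \<Rightarrow> bool" where
  "covers E b n \<longleftrightarrow> (\<exists>x. (\<Sum>e\<in>E. x e) = n \<and> (\<forall>v. b v \<le> edge_degree E x v))"

text \<open>The handshake lemma, with multiplicities.\<close>

lemma sum_edge_degree:
  fixes E :: "'v::finite set set"
  assumes "\<forall>e\<in>E. card e = 2"
  shows "(\<Sum>v\<in>UNIV. edge_degree E x v) = 2 * (\<Sum>e\<in>E. x e)"
proof -
  have "(\<Sum>v\<in>UNIV. edge_degree E x v) = (\<Sum>e\<in>E. \<Sum>v\<in>UNIV. x e * of_bool (v \<in> e))"
    unfolding edge_degree_def by (rule sum.swap)
  also have "\<dots> = (\<Sum>e\<in>E. x e * card e)"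
    by (simp flip: sum_distrib_left)
  also have "\<dots> = (\<Sum>e\<in>E. 2 * x e)"
    using assms by (intro sum.cong) auto
  also have "\<dots> = 2 * (\<Sum>e\<in>E. x e)"
    by (rule sum_distrib_left[symmetric])
  finally show ?thesis .
qed

lemma edge_degree_mono: "(\<And>e. x e \<le> y e) \<Longrightarrow> edge_degree E x v \<le> edge_degree E y v"
  unfolding edge_degree_def by (intro sum_mono mult_right_mono) auto

lemma edge_degree_add:
  "edge_degree E (\<lambda>e. x e + y e) v = edge_degree E x v + edge_degree E y v"
  unfolding edge_degree_def by (simp add: sum.distrib algebra_simps)

lemma edge_degree_delta:
  assumes "finite E" "e0 \<in> E"
  shows "edge_degree E (\<lambda>e. if e = e0 then c else 0) v = c * of_bool (v \<in> e0)"
  unfolding edge_degree_def using assms by (simp add: if_distrib[of "\<lambda>x. x * _"] cong: if_cong)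

lemma edge_degree_le_sum: "edge_degree E x v \<le> (\<Sum>e\<in>E. x e)"
  unfolding edge_degree_def by (rule sum_mono) simp

lemma packs_antimono:
  fixes E :: "'v::finite set set"
  assumes "packs E b n" "k \<le> n"
  shows "packs E b k"
proof -
  obtain x where x: "(\<Sum>e\<in>E. x e) = n" "\<And>v. edge_degree E x v \<le> b v"
    using assms unfolding packs_def by auto
  obtain y where y: "\<And>e. y e \<le> x e" "(\<Sum>e\<in>E. y e) = k"
    using ex_weights_below[of E k x] assms(2) x(1) by auto
  have "edge_degree E y v \<le> b v" for v
    using edge_degree_mono[of y x, OF y(1)] x(2) order_trans by blast
  with y(2) show ?thesis unfolding packs_def by blast
qed

lemma covers_mono:
  fixes E :: "'v::finite set set"
  assumes "covers E b n" "n \<le> k" "E \<noteq> {}"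
  shows "covers E b k"
proof -
  obtain x where x: "(\<Sum>e\<in>E. x e) = n" "\<And>v. b v \<le> edge_degree E x v"
    using assms unfolding covers_def by auto
  obtain e0 where e0: "e0 \<in> E" using assms by auto
  let ?y = "\<lambda>e. x e + (if e = e0 then k - n else 0)"
  have "(\<Sum>e\<in>E. ?y e) = k" using x e0 assms(2) by (simp add: sum.distrib)
  moreover have "b v \<le> edge_degree E ?y v" for v
    using x(2)[of v] edge_degree_mono[of x ?y E v] by auto
  ultimately show ?thesis unfolding covers_def by (intro exI[of _ ?y]) auto
qed

text \<open>One half of Gallai's identity: a packing of size \<open>n\<close> has total degree \<open>2n\<close>, so \<open>|b| - 2n\<close> units of
  demand are missing. Adding one edge at \<open>v\<close> for each unit missing at \<open>v\<close> produces a covering with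
  \<open>n + (|b| - 2n) = |b| - n\<close> edges, which can be padded to any larger size.\<close>

lemma packs_imp_covers:
  fixes E :: "'v::finite set set"
  assumes E: "\<forall>e\<in>E. card e = 2" "E \<noteq> {}" and supp: "\<And>v. 0 < b v \<Longrightarrow> v \<in> \<Union>E"
    and p: "packs E b n" and k: "(\<Sum>v\<in>UNIV. b v) \<le> n + k"
  shows "covers E b k"
proof -
  obtain x where x: "(\<Sum>e\<in>E. x e) = n" "\<And>v. edge_degree E x v \<le> b v"
    using p unfolding packs_def by auto
  \<comment> \<open>The demand missing at \<open>v\<close>, to be met by copies of one chosen edge \<open>h v\<close> through \<open>v\<close>.\<close>
  define d where "d v = b v - edge_degree E x v" for v
  have "\<forall>v\<in>\<Union>E. \<exists>e\<in>E. v \<in> e" by blast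
  then obtain h where h: "\<And>v. v \<in> \<Union>E \<Longrightarrow> h v \<in> E \<and> v \<in> h v" by metis
  define y where "y e = x e + (\<Sum>v\<in>\<Union>E. if e = h v then d v else 0)" for e
  have d0: "d v = 0" if "v \<notin> \<Union>E" for v 
  proof -
    have "b v = 0" using supp[of v] that by blast
    then show ?thesis by (simp add: d_def)
  qed
  have "(\<Sum>e\<in>E. y e) = n + (\<Sum>v\<in>\<Union>E. \<Sum>e\<in>E. if e = h v then d v else 0)"
    unfolding y_def sum.distrib x(1) by (subst sum.swap) simp
  also have "(\<Sum>v\<in>\<Union>E. \<Sum>e\<in>E. if e = h v then d v else 0) = (\<Sum>v\<in>\<Union>E. d v)"
    using h by (intro sum.cong) auto
  also have "\<dots> = (\<Sum>v\<in>UNIV. d v)"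
    using d0 by (intro sum.mono_neutral_left) auto
  also have "\<dots> = (\<Sum>v\<in>UNIV. b v) - 2 * n"
    unfolding d_def using x(2) by (simp add: sum_subtractf_nat sum_edge_degree[OF E(1)] x(1))
  also have "n + \<dots> \<le> k"
  proof -
    have "2 * n \<le> (\<Sum>v\<in>UNIV. b v)"
      using sum_mono[of UNIV "edge_degree E x" b] x by (simp add: sum_edge_degree[OF E(1)])
    with k show ?thesis by simp
  qed
  finally have size: "(\<Sum>e\<in>E. y e) \<le> k" .
  have "b v \<le> edge_degree E y v" for v
  proof (cases "v \<in> \<Union>E")
    case True
    have "edge_degree E x v + d v = edge_degree E (\<lambda>e. x e + (if e = h v then d v else 0)) v"
      using h[OF True] by (simp add: edge_degree_add edge_degree_delta)
    also have "\<dots> \<le> edge_degree E y v"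
      unfolding y_def using member_le_sum[of v "\<Union>E" "\<lambda>w. if h v = h w then d w else 0"] True
      by (intro edge_degree_mono) simp
    finally show ?thesis unfolding d_def by simp
  next
    case False
    with supp[of v] have "b v = 0" by auto
    then show ?thesis by simp
  qed
  then have "covers E b (\<Sum>e\<in>E. y e)" unfolding covers_def by blast
  with size E(2) show ?thesis using covers_mono by blast
qed

text \<open>Deleting an edge at a vertex that exceeds its capacity lowers the total excess by at least one.
  So the number of deletions needed is at most the total excess.\<close>

lemma ex_packing_below:
  fixes E :: "'v::finite set set"
  shows "\<exists>y. (\<forall>v. edge_degree E y v \<le> b v) \<and>
    (\<Sum>e\<in>E. x e) \<le> (\<Sum>e\<in>E. y e) + (\<Sum>v\<in>UNIV. edge_degree E x v - b v)"
proof (induction "\<Sum>e\<in>E. x e" arbitrary: x rule: less_induct)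
  case less
  show ?case
  proof (cases "\<forall>v. edge_degree E x v \<le> b v")
    case True
    then show ?thesis by (intro exI[of _ x]) simp
  next
    case False
    then obtain v where v: "b v < edge_degree E x v" by (auto simp: not_le)
    then have "edge_degree E x v \<noteq> 0" by simp
    then obtain e0 where e0: "e0 \<in> E" "v \<in> e0" "x e0 \<noteq> 0"
      unfolding edge_degree_def by (auto split: if_splits)
    define x' where "x' = x(e0 := x e0 - 1)"
    define one where "one = (\<lambda>e. if e = e0 then 1 else 0 :: nat)"
    have x: "x = (\<lambda>e. x' e + one e)" using e0 by (auto simp: x'_def one_def)
    have size: "(\<Sum>e\<in>E. x e) = Suc (\<Sum>e\<in>E. x' e)"
      using e0(1) by (subst x) (simp add: sum.distrib one_def)
    have deg: "edge_degree E x u = edge_degree E x' u + of_bool (u \<in> e0)" for u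
      using e0(1) by (subst x) (simp add: edge_degree_add one_def edge_degree_delta)
    have "(\<Sum>u\<in>UNIV. edge_degree E x' u - b u) < (\<Sum>u\<in>UNIV. edge_degree E x u - b u)"
    proof (rule sum_strict_mono_ex1)
      show "\<forall>u\<in>UNIV. edge_degree E x' u - b u \<le> edge_degree E x u - b u"
        by (simp add: deg diff_le_mono)
      show "\<exists>u\<in>UNIV. edge_degree E x' u - b u < edge_degree E x u - b u"
        using v e0(2) deg[of v] by (intro bexI[of _ v]) auto
    qed simp
    moreover obtain y where "\<forall>v. edge_degree E y v \<le> b v"
      "(\<Sum>e\<in>E. x' e) \<le> (\<Sum>e\<in>E. y e) + (\<Sum>v\<in>UNIV. edge_degree E x' v - b v)"
      using less[of x'] size by auto
    ultimately show ?thesis using size by (intro exI[of _ y]) simp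
  qed
qed

text \<open>The other half of Gallai's identity: a covering of size \<open>n\<close> has total excess \<open>2n - |b|\<close>, so
  at least \<open>n - (2n - |b|) = |b| - n\<close> edges survive.\<close>

lemma covers_imp_packs:
  fixes E :: "'v::finite set set"
  assumes E: "\<forall>e\<in>E. card e = 2"
    and c: "covers E b n" and k: "n + k \<le> (\<Sum>v\<in>UNIV. b v)"
  shows "packs E b k"
proof -
  obtain x where x: "(\<Sum>e\<in>E. x e) = n" "\<And>v. b v \<le> edge_degree E x v"
    using c unfolding covers_def by auto
  obtain y where y: "\<forall>v. edge_degree E y v \<le> b v"
      "n \<le> (\<Sum>e\<in>E. y e) + (\<Sum>v\<in>UNIV. edge_degree E x v - b v)"
    using ex_packing_below[of E b x] x(1) by auto
  have "(\<Sum>v\<in>UNIV. edge_degree E x v - b v) = 2 * n - (\<Sum>v\<in>UNIV. b v)"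
    using x(2) by (simp add: sum_subtractf_nat sum_edge_degree[OF E] x(1))
  moreover have "(\<Sum>v\<in>UNIV. b v) \<le> 2 * n"
    using sum_mono[of UNIV b "edge_degree E x"] x by (simp add: sum_edge_degree[OF E])
  ultimately have "k \<le> (\<Sum>e\<in>E. y e)" using y(2) k by simp
  moreover have "packs E b (\<Sum>e\<in>E. y e)" using y(1) unfolding packs_def by blast
  ultimately show ?thesis using packs_antimono by blast
qed

text \<open>Applied to \<open>kb\<close>, Gallai's identity exchanges packings of size \<open>nk\<close> with coverings of size
  \<open>(|b| - n)k\<close>; applied to \<open>b\<close>, it exchanges sizes \<open>n\<close> and \<open>|b| - n\<close>. Isolated vertices need care:
  a demand there cannot be covered at all, whereas a packing may be given capacity there, which no
  edge can use and which is therefore set to \<open>0\<close> first.\<close>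

lemma packing_rounding_iff_covering_rounding:
  fixes E :: "'v::finite set set"
  assumes E: "\<forall>e\<in>E. card e = 2" "E \<noteq> {}"
  shows "(\<forall>n\<ge>1. \<forall>k\<ge>1. \<forall>a. packs E (\<lambda>v. k * a v) (n * k) \<longrightarrow> packs E a n) \<longleftrightarrow>
    (\<forall>n\<ge>1. \<forall>k\<ge>1. \<forall>b. covers E (\<lambda>v. k * b v) (n * k) \<longrightarrow> covers E b n)"
    (is "?packing \<longleftrightarrow> ?covering")
proof
  assume P: ?packing
  show ?covering
  proof (intro allI impI)
    fix n k :: nat and b
    assume nk: "n \<ge> 1" "k \<ge> 1" and c: "covers E (\<lambda>v. k * b v) (n * k)"
    let ?s = "\<Sum>v\<in>UNIV. b v"
    have supp: "v \<in> \<Union>E" if "0 < b v" for v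
    proof (rule ccontr)
      assume "v \<notin> \<Union>E"
      then have "edge_degree E x v = 0" for x unfolding edge_degree_def by (intro sum.neutral) auto
      with c have "k * b v \<le> 0" unfolding covers_def by metis
      with that nk show False by simp
    qed
    have "packs E b (?s - n)"
    proof (cases "?s \<le> n")
      case True
      then show ?thesis unfolding packs_def by (intro exI[of _ "\<lambda>_. 0"]) (simp add: edge_degree_def)
    next
      case False
      have "n * k + (?s - n) * k = ?s * k" using False by (simp flip: add_mult_distrib)
      then have "packs E (\<lambda>v. k * b v) ((?s - n) * k)"
        using covers_imp_packs[OF E(1) c, of "(?s - n) * k"]
        by (simp add: mult.commute flip: sum_distrib_left)
      with P[rule_format, of "?s - n" k b] nk False show ?thesis by simp
    qed
    then show "covers E b n"
      using packs_imp_covers[OF E, of b "?s - n" n] supp by simp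
  qed
next
  assume C: ?covering
  show ?packing
  proof (intro allI impI)
    fix n k :: nat and a
    assume nk: "n \<ge> 1" "k \<ge> 1" and "packs E (\<lambda>v. k * a v) (n * k)"
    then obtain x where x: "(\<Sum>e\<in>E. x e) = n * k" "\<And>v. edge_degree E x v \<le> k * a v"
      unfolding packs_def by auto
    define b where "b v = (if v \<in> \<Union>E then a v else 0)" for v
    let ?s = "\<Sum>v\<in>UNIV. b v"
    have deg: "edge_degree E x v \<le> k * b v" for v
    proof (cases "v \<in> \<Union>E")
      case False
      then have "edge_degree E x v = 0" unfolding edge_degree_def by (intro sum.neutral) auto
      then show ?thesis by simp
    qed (use x(2) in \<open>simp add: b_def\<close>)
    have p: "packs E (\<lambda>v. k * b v) (n * k)"
      unfolding packs_def using x(1) deg by blast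
    have "2 * (n * k) \<le> k * ?s"
      using sum_mono[of UNIV "edge_degree E x" "\<lambda>v. k * b v"] deg x(1)
      by (simp add: sum_edge_degree[OF E(1)] sum_distrib_left)
    then have "k * (2 * n) \<le> k * ?s" by (simp add: ac_simps)
    then have s: "2 * n \<le> ?s" using nk by simp
    then have "n * k + (?s - n) * k = ?s * k" by (simp flip: add_mult_distrib)
    then have "(\<Sum>v\<in>UNIV. k * b v) \<le> n * k + (?s - n) * k"
      by (simp add: mult.commute flip: sum_distrib_left)
    then have "covers E (\<lambda>v. k * b v) ((?s - n) * k)"
      by (intro packs_imp_covers[OF E _ p]) (auto simp: b_def split: if_splits)
    moreover have "?s - n \<ge> 1" using s nk by simp
    ultimately have "covers E b (?s - n)" using C nk by blast
    then have "packs E b n"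
      by (rule covers_imp_packs[OF E(1)]) (use s in simp)
    moreover have "b v \<le> a v" for v by (simp add: b_def)
    ultimately show "packs E a n" unfolding packs_def using order_trans by blast
  qed
qed

section \<open>Edge ideals and their duals\<close>

definition indicator_exponent :: "'v set \<Rightarrow> 'v \<Rightarrow>\<^sub>0 nat" where
  "indicator_exponent e = (\<Sum>v\<in>e. Poly_Mapping.single v 1)"

lemma lookup_indicator_exponent:
  "Poly_Mapping.lookup (indicator_exponent e) v = of_bool ((v::'v::finite) \<in> e)"
  by (simp add: indicator_exponent_def lookup_sum lookup_single when_def)

lemma prod_var: "(\<Prod>v\<in>e. var v) = Poly_Mapping.single (indicator_exponent e) (1::'k::field)"
  unfolding var_def indicator_exponent_def by (rule prod_single)

lemma edge_ideal_eq:
  fixes E :: "'v::finite set set"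
  shows "(edge_ideal E :: ('v, 'k::field) mpoly set) =
    monomial_ideal (power_exponents E indicator_exponent 1)"
  unfolding edge_ideal_def edge_monomial_def[abs_def] prod_var by (rule ideal_gen_monomials) simp

lemma dual_edge_ideal_eq:
  fixes E :: "'v::finite set set"
  shows "(dual_edge_ideal E :: ('v, 'k::field) mpoly set) =
    monomial_ideal (power_exponents E (\<lambda>e. indicator_exponent (UNIV - e)) 1)"
  unfolding dual_edge_ideal_def dual_monomial_def[abs_def] prod_var by (rule ideal_gen_monomials) simp

lemma all_exponents_iff:
  "(\<forall>a::'v::finite \<Rightarrow>\<^sub>0 nat. P (Poly_Mapping.lookup a)) \<longleftrightarrow> (\<forall>a. P a)"
proof
  assume P: "\<forall>a::'v \<Rightarrow>\<^sub>0 nat. P (Poly_Mapping.lookup a)"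
  show "\<forall>a. P a"
  proof
    fix a :: "'v \<Rightarrow> nat"
    show "P a" using P[rule_format, of "Abs_poly_mapping a"] by simp
  qed
qed simp

lemma mem_power_exponents_edges_iff:
  "a \<in> power_exponents E indicator_exponent n \<longleftrightarrow> packs E (Poly_Mapping.lookup (a::'v::finite \<Rightarrow>\<^sub>0 nat)) n"
  by (simp add: power_exponents_def packs_def edge_degree_def lookup_indicator_exponent)

text \<open>Among \<open>n\<close> edges, those missing \<open>v\<close> number \<open>n - deg v\<close>. The truncated subtraction is harmless: where
  \<open>a v \<ge> n\<close>, the exponent imposes no condition, and neither does the demand \<open>0\<close>.\<close>

lemma mem_power_exponents_dual_iff:
  fixes E :: "'v::finite set set"
  shows "a \<in> power_exponents E (\<lambda>e. indicator_exponent (UNIV - e)) n \<longleftrightarrow>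
    covers E (\<lambda>v. n - Poly_Mapping.lookup a v) n"
proof -
  have sum: "(\<Sum>e\<in>E. x e * of_bool (v \<notin> e)) + edge_degree E x v = (\<Sum>e\<in>E. x e)" for x v
    unfolding edge_degree_def sum.distrib[symmetric] by (rule sum.cong) auto
  have "(\<Sum>e\<in>E. x e * of_bool (v \<notin> e)) \<le> Poly_Mapping.lookup a v \<longleftrightarrow>
      n - Poly_Mapping.lookup a v \<le> edge_degree E x v" if "(\<Sum>e\<in>E. x e) = n" for x v
      proof -
    have "(\<Sum>e\<in>E. x e * of_bool (v \<notin> e)) + edge_degree E x v = n"
      using sum[of x v] that by simp
    then show ?thesis by linarith
  qed
  then show ?thesis
    by (auto simp: power_exponents_def covers_def lookup_indicator_exponent)
qed

lemma normal_edge_ideal_iff: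
  fixes E :: "'v::finite set set"
  assumes "E \<noteq> {}"
  shows "normal_ideal (edge_ideal E :: ('v, 'k::field) mpoly set) \<longleftrightarrow>
    (\<forall>n\<ge>1. \<forall>k\<ge>1. \<forall>a. packs E (\<lambda>v. k * a v) (n * k) \<longrightarrow> packs E a n)"
proof -
  have "Poly_Mapping.lookup (\<Sum>i<k. a) = (\<lambda>v. k * Poly_Mapping.lookup a v)"
    for k and a :: "'v \<Rightarrow>\<^sub>0 nat"
    by (auto simp: lookup_sum)
  then show ?thesis
    unfolding edge_ideal_eq normal_monomial_ideal_iff[OF finite assms] mem_power_exponents_edges_iff
      all_exponents_iff[symmetric]
    by simp
qed

text \<open>The demands that come from exponents are exactly those bounded by \<open>n\<close>. This bound can be dropped:
  \<open>n k\<close> edges have degree at most \<open>n k\<close> at each vertex, so \<open>k b\<close> can be covered only if \<open>b \<le> n\<close>.\<close>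

lemma normal_dual_edge_ideal_iff:
  fixes E :: "'v::finite set set"
  assumes "E \<noteq> {}"
  shows "normal_ideal (dual_edge_ideal E :: ('v, 'k::field) mpoly set) \<longleftrightarrow>
    (\<forall>n\<ge>1. \<forall>k\<ge>1. \<forall>b. covers E (\<lambda>v. k * b v) (n * k) \<longrightarrow> covers E b n)"
    (is "_ \<longleftrightarrow> ?rounding")
proof -
  have eq: "n * k - Poly_Mapping.lookup (\<Sum>i<k. a) v = k * (n - Poly_Mapping.lookup a v)"
    for n k v and a :: "'v \<Rightarrow>\<^sub>0 nat"
    by (simp add: lookup_sum diff_mult_distrib2 mult.commute)
  have "normal_ideal (dual_edge_ideal E :: ('v, 'k) mpoly set) \<longleftrightarrow>
      (\<forall>n\<ge>1. \<forall>k\<ge>1. \<forall>a::'v \<Rightarrow>\<^sub>0 nat. covers E (\<lambda>v. k * (n - Poly_Mapping.lookup a v)) (n * k) \<longrightarrow>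
        covers E (\<lambda>v. n - Poly_Mapping.lookup a v) n)"
    unfolding dual_edge_ideal_eq normal_monomial_ideal_iff[OF finite assms] mem_power_exponents_dual_iff
      eq ..
  also have "\<dots> \<longleftrightarrow> (\<forall>n\<ge>1. \<forall>k\<ge>1. \<forall>a::'v \<Rightarrow> nat. covers E (\<lambda>v. k * (n - a v)) (n * k) \<longrightarrow>
        covers E (\<lambda>v. n - a v) n)"
    by (simp only: all_exponents_iff[of "\<lambda>a. covers E (\<lambda>v. _ * (_ - a v)) _ \<longrightarrow> covers E (\<lambda>v. _ - a v) _"])
  also have "\<dots> \<longleftrightarrow> ?rounding"
  proof
    assume R: "\<forall>n\<ge>1. \<forall>k\<ge>1. \<forall>a. covers E (\<lambda>v. k * (n - a v)) (n * k) \<longrightarrow> covers E (\<lambda>v. n - a v) n"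
    show ?rounding
    proof (intro allI impI)
      fix n k :: nat and b
      assume nk: "n \<ge> 1" "k \<ge> 1" and c: "covers E (\<lambda>v. k * b v) (n * k)"
      have "k * b v \<le> k * n" for v
        using c edge_degree_le_sum[of E _ v] unfolding covers_def
        by (metis mult.commute order_trans)
      then have "b v \<le> n" for v using nk by simp
      then have "(\<lambda>v. n - (n - b v)) = b" by auto
      with R[rule_format, OF nk, of "\<lambda>v. n - b v"] c show "covers E b n" by (simp add: fun_eq_iff)
    qed
  next
    assume R: ?rounding
    show "\<forall>n\<ge>1. \<forall>k\<ge>1. \<forall>a. covers E (\<lambda>v. k * (n - a v)) (n * k) \<longrightarrow> covers E (\<lambda>v. n - a v) n"
    proof (intro allI impI)
      fix n k :: nat and a
      assume "n \<ge> 1" "k \<ge> 1" "covers E (\<lambda>v. k * (n - a v)) (n * k)"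
      then show "covers E (\<lambda>v. n - a v) n" by (rule R[rule_format])
    qed
  qed
  finally show ?thesis .
qed

theorem proposition4p7:
  fixes E :: "'v::finite set set"
  assumes "simple_graph (UNIV :: 'v set) E"
  shows "normal_ideal (dual_edge_ideal E :: ('v, 'k::field) mpoly set) \<longleftrightarrow>
         normal_ideal (edge_ideal E :: ('v, 'k) mpoly set)"
proof (cases "E = {}")
  \<comment> \<open>Without edges both ideals are zero.\<close>
  case True
  then show ?thesis by (simp add: dual_edge_ideal_def edge_ideal_def)
next
  case False
  have "\<forall>e\<in>E. card e = 2" using assms by (simp add: simple_graph_def)
  from packing_rounding_iff_covering_rounding[OF this False] show ?thesis
    by (simp add: normal_edge_ideal_iff[OF False] normal_dual_edge_ideal_iff[OF False])
qed

end
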